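(* Let $A\in\mathbb{R}^{n\times n}$ be diagonalizable, $A=PDP^{-1}$ with $P\in\mathbb{C}^{n\times n}$ invertible and $D\in\mathbb{C}^{n\times n}$ diagonal with diagonal entries $d_{11},\dots,d_{nn}$, and suppose every eigenvalue of $A$ is simple. Let $b,c\in\mathbb{R}^n$ be such that $c^T(A-sI)^{-1}b\neq 0$ for all $s\in\mathbb{C}\setminus\lambda(A)$ and $c^TPe_k\,e_k^TP^{-1}b\neq 0$ for $k=1,\dots,n$. Let $1\le p\le n$ and let $\lambda_1,\dots,\lambda_p$ be $p$ distinct eigenvalues of $A$. Then there is a neighborhood $V$ of $(\lambda_1,\dots,\lambda_p)^T$ in $\mathbb{C}^p$ such that, for any $S_0\in V$, the Dominant Pole Spectrum Eigensolver (DPSE) iteration $S_{r+1}=G(S_r)$, $r\ge 0$, started at $S_0$ converges at least quadratically to $(\lambda_1,\dots,\lambda_p)^T$, where $G$ is the DPSE map defined in the context.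
   Context: $\lambda(A)$ denotes the spectrum of $A$, $e_1,e_2,\dots$ are the canonical basis vectors (of the appropriate dimension), and $^T$ is the plain transpose (no conjugation). With $A=PDP^{-1}$, $b$, $c$ as in the claim, define $f,g:\mathbb{C}\to\mathbb{C}^n$ by $$f(s)=\frac{(A-sI)^{-1}b}{c^T(A-sI)^{-1}b}\ \text{ for } s\in\mathbb{C}\setminus\lambda(A),\qquad f(d_{jj})=\frac{Pe_j}{c^TPe_j},\quad j=1,\dots,n,$$ $$g(s)=\frac{(A^T-sI)^{-1}c}{c^T(A-sI)^{-1}b}\ \text{ for } s\in\mathbb{C}\setminus\lambda(A),\qquad g(d_{jj})=\frac{P^{-T}e_j}{b^TP^{-T}e_j},\quad j=1,\dots,n,$$ where $P^{-T}=(P^{-1})^T$. For $S=(s_1,\dots,s_p)^T\in\mathbb{C}^p$, $X(S),Y(S)\in\mathbb{C}^{n\times p}$ are the matrices whose $k$-th columns are $X(S)e_k=f(s_k)$ and $Y(S)e_k=g(s_k)$, $k=1,\dots,p$. Wherever $Y(S)^TX(S)$ is invertible (which holds on an open neighborhood of $(\lambda_1,\dots,\lambda_p)^T$), put $$F(S)=\left(Y(S)^TX(S)\right)^{-1}\left(Y(S)^TAX(S)\right)\in\mathbb{C}^{p\times p}.$$ One has $F\left((\lambda_1,\dots,\lambda_p)^T\right)=\mathrm{diag}(\lambda_1,\dots,\lambda_p)$, and the eigenvalues of $F(S)$ are simple for $S$ in an open neighborhood $\mathcal{Z}$ of $(\lambda_1,\dots,\lambda_p)^T$. DPSE is the fixed-point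 iteration applied to the map $G:\mathcal{Z}\to\mathbb{C}^p$, $G(S)=(\lambda_1(F(S)),\dots,\lambda_p(F(S)))^T$, where $\lambda_1(F(S)),\dots,\lambda_p(F(S))$ are the $p$ eigenvalues of $F(S)$, labelled (with $\mathcal{Z}$ sufficiently small) so that each $\lambda_i(F(S))$ depends continuously on $S$ and $\lambda_i\left(F\left((\lambda_1,\dots,\lambda_p)^T\right)\right)=\lambda_i$; thus $(\lambda_1,\dots,\lambda_p)^T$ is a fixed point of $G$. "Converges at least quadratically to $S^*$" means that all iterates are well defined, $S_r\to S^*$, and there is a constant $C$ with $\|S_{r+1}-S^*\|\le C\|S_r-S^*\|^2$ for all $r\ge 0$. *)

theory Defs
  imports "HOL-Analysis.Analysis" "HOL-Computational_Algebra.Polynomial"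
begin

definition complex_mat :: "real^'n^'m \<Rightarrow> complex^'n^'m"
  where "complex_mat M = map_matrix complex_of_real M"

definition complex_vec :: "real^'n \<Rightarrow> complex^'n"
  where "complex_vec v = (\<chi> i. complex_of_real (v $ i))"

definition mat_spectrum :: "complex^'n^'n \<Rightarrow> complex set"
  where "mat_spectrum M = {z. \<exists>v. v \<noteq> 0 \<and> M *v v = z *s v}"

definition charpoly :: "complex^'n^'n \<Rightarrow> complex poly"
  where "charpoly M = det (mat [:0, 1:] - map_matrix (\<lambda>a. [:a:]) M)"

definition simple_eigenvalue :: "complex^'n^'n \<Rightarrow> complex \<Rightarrow> bool"
  where "simple_eigenvalue M z \<longleftrightarrow> z \<in> mat_spectrum M \<and> order z (charpoly M) = 1"

definition diagonal_mat :: "complex^'n^'n \<Rightarrow> bool"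
  where "diagonal_mat D \<longleftrightarrow> (\<forall>i j. i \<noteq> j \<longrightarrow> D $ i $ j = 0)"

definition resolvent :: "complex^'n^'n \<Rightarrow> complex \<Rightarrow> complex^'n^'n"
  where "resolvent M s = matrix_inv (M - mat s)"

(* scalar_product x y is x^T y without conjugation, whereas the inner product on
   complex vectors is the real one *)
definition transfer_function :: "complex^'n^'n \<Rightarrow> complex^'n \<Rightarrow> complex^'n \<Rightarrow> complex \<Rightarrow> complex"
  where "transfer_function A b c s = scalar_product c (resolvent A s *v b)"

(* In dpse_f and dpse_g, P and D are meant to satisfy A = P D P^(-1) with D diagonal with
   pairwise distinct diagonal entries, so that the index selected by THE exists and is
   unique whenever s is in the spectrum of A. *)
definition dpse_f ::
    "complex^'n^'n \<Rightarrow> complex^'n \<Rightarrow> complex^'n \<Rightarrow> complex^'n^'n \<Rightarrow> complex^'n^'n \<Rightarrow> complex \<Rightarrow> complex^'n"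
  where "dpse_f A b c P D s =
    (if s \<notin> mat_spectrum A then inverse (transfer_function A b c s) *s (resolvent A s *v b)
     else let v = P *v axis (THE j. D $ j $ j = s) 1
          in inverse (scalar_product c v) *s v)"

definition dpse_g ::
    "complex^'n^'n \<Rightarrow> complex^'n \<Rightarrow> complex^'n \<Rightarrow> complex^'n^'n \<Rightarrow> complex^'n^'n \<Rightarrow> complex \<Rightarrow> complex^'n"
  where "dpse_g A b c P D s =
    (if s \<notin> mat_spectrum A then inverse (transfer_function A b c s) *s (resolvent (transpose A) s *v c)
     else let w = transpose (matrix_inv P) *v axis (THE j. D $ j $ j = s) 1
          in inverse (scalar_product b w) *s w)"

definition dpse_X ::
    "complex^'n^'n \<Rightarrow> complex^'n \<Rightarrow> complex^'n \<Rightarrow> complex^'n^'n \<Rightarrow> complex^'n^'n \<Rightarrow> complex^'p \<Rightarrow> complex^'p^'n"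
  where "dpse_X A b c P D S = (\<chi> i k. dpse_f A b c P D (S $ k) $ i)"

definition dpse_Y ::
    "complex^'n^'n \<Rightarrow> complex^'n \<Rightarrow> complex^'n \<Rightarrow> complex^'n^'n \<Rightarrow> complex^'n^'n \<Rightarrow> complex^'p \<Rightarrow> complex^'p^'n"
  where "dpse_Y A b c P D S = (\<chi> i k. dpse_g A b c P D (S $ k) $ i)"

definition dpse_gram ::
    "complex^'n^'n \<Rightarrow> complex^'n \<Rightarrow> complex^'n \<Rightarrow> complex^'n^'n \<Rightarrow> complex^'n^'n \<Rightarrow> complex^'p \<Rightarrow> complex^'p^'p"
  where "dpse_gram A b c P D S = transpose (dpse_Y A b c P D S) ** dpse_X A b c P D S"

definition dpse_F ::
    "complex^'n^'n \<Rightarrow> complex^'n \<Rightarrow> complex^'n \<Rightarrow> complex^'n^'n \<Rightarrow> complex^'n^'n \<Rightarrow> complex^'p \<Rightarrow> complex^'p^'p"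
  where "dpse_F A b c P D S =
    matrix_inv (dpse_gram A b c P D S) **
    (transpose (dpse_Y A b c P D S) ** A ** dpse_X A b c P D S)"

(* G, with domain Z, is a DPSE map at lam: on the open neighborhood Z of lam, F is well
   defined with p simple eigenvalues, and the components of G are these eigenvalues,
   labelled so as to depend continuously on S and to agree with lam at S = lam.
   Values of G outside Z are irrelevant. *)
definition is_dpse_map ::
    "complex^'n^'n \<Rightarrow> complex^'n \<Rightarrow> complex^'n \<Rightarrow> complex^'n^'n \<Rightarrow> complex^'n^'n \<Rightarrow> complex^'p
      \<Rightarrow> (complex^'p) set \<Rightarrow> (complex^'p \<Rightarrow> complex^'p) \<Rightarrow> bool"
  where "is_dpse_map A b c P D lam Z G \<longleftrightarrow>
    open Z \<and> lam \<in> Z \<and>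
    (\<forall>S\<in>Z. invertible (dpse_gram A b c P D S) \<and>
           (\<forall>z\<in>mat_spectrum (dpse_F A b c P D S). simple_eigenvalue (dpse_F A b c P D S) z) \<and>
           bij_betw (\<lambda>i. G S $ i) UNIV (mat_spectrum (dpse_F A b c P D S))) \<and>
    continuous_on Z G \<and> G lam = lam"

(* The requirement that all iterates lie in the domain Z of G expresses that they are
   well defined. *)
definition iteration_converges_quadratically ::
    "'a::real_normed_vector set \<Rightarrow> ('a \<Rightarrow> 'a) \<Rightarrow> 'a \<Rightarrow> 'a \<Rightarrow> bool"
  where "iteration_converges_quadratically Z G S0 L \<longleftrightarrow>
    (\<forall>r. (G ^^ r) S0 \<in> Z) \<and>
    (\<lambda>r. (G ^^ r) S0) \<longlonglongrightarrow> L \<and>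
    (\<exists>C. \<forall>r. norm ((G ^^ Suc r) S0 - L) \<le> C * (norm ((G ^^ r) S0 - L))\<^sup>2)"

end

theory Submission
  imports Defs "HOL-Library.Landau_Symbols" "HOL-Computational_Algebra.Fundamental_Theorem_Algebra"
begin

text \<open>
  In the eigenbasis of \<open>A\<close>, clearing denominators shows that \<open>f\<close> and \<open>g\<close> have the coordinates
  \<open>\<beta>\<^sub>j \<phi>\<^sub>j(s)\<close> and \<open>\<gamma>\<^sub>j \<phi>\<^sub>j(s)\<close> for every complex \<open>s\<close>, where \<open>\<phi>\<^sub>j\<close> is continuous everywhere and
  vanishes at all eigenvalues other than \<open>d\<^sub>j\<close>. Hence \<open>det (z - F(S))\<close> is the quotient by
  \<open>det (Y\<^sup>T X)\<close> of the determinant of the matrix with entries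
  \<open>\<Sum>\<^sub>j (z - d\<^sub>j) \<beta>\<^sub>j \<gamma>\<^sub>j \<phi>\<^sub>j(s\<^sub>k) \<phi>\<^sub>j(s\<^sub>l)\<close>. For \<open>z = \<lambda>\<^sub>i\<close> and \<open>S\<close> at distance \<open>\<delta>\<close> from the fixed point,
  the \<open>i\<close>-th row and column of this matrix are \<open>O(\<delta>)\<close> and its \<open>i\<close>-th diagonal entry is
  \<open>O(\<delta>\<^sup>2)\<close>, so its determinant, and with it the product of all \<open>\<lambda>\<^sub>i - \<lambda>\<^sub>j(F(S))\<close>, is
  \<open>O(\<delta>\<^sup>2)\<close>. The factors with \<open>j \<noteq> i\<close> stay away from zero. A continuous labelling of the
  eigenvalues exists because a monic polynomial of degree \<open>p\<close> whose value at \<open>z\<close> is smaller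
  than \<open>\<epsilon>\<^sup>p\<close> has a root within \<open>\<epsilon>\<close> of \<open>z\<close>.
\<close>

section \<open>Matrix inverses and characteristic polynomials\<close>

lemma matrix_inv_mult:
  fixes A :: "'a::semiring_1^'n^'m"
  assumes "invertible A"
  shows "A ** matrix_inv A = mat 1" "matrix_inv A ** A = mat 1"
proof -
  have "A ** matrix_inv A = mat 1 \<and> matrix_inv A ** A = mat 1"
    unfolding matrix_inv_def using assms unfolding invertible_def by (rule someI_ex)
  then show "A ** matrix_inv A = mat 1" "matrix_inv A ** A = mat 1" by auto
qed

lemma matrix_inv_eqI:
  fixes A B :: "'a::field^'n^'n"
  assumes "B ** A = mat 1"
  shows "invertible A" "matrix_inv A = B"
proof -
  show inv: "invertible A"
    using assms invertible_left_inverse by blast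
  show "matrix_inv A = B"
    by (metis assms inv matrix_inv_mult(1) matrix_mul_assoc matrix_mul_lid matrix_mul_rid)
qed

lemma matrix_inv_transpose:
  fixes P :: "'a::field^'n^'n"
  assumes "invertible P"
  shows "invertible (transpose (matrix_inv P))"
    "matrix_inv (transpose (matrix_inv P)) = transpose P"
proof -
  have "transpose P ** transpose (matrix_inv P) = mat 1"
    using matrix_inv_mult(2)[OF assms] by (metis matrix_transpose_mul transpose_mat)
  then show "invertible (transpose (matrix_inv P))"
    "matrix_inv (transpose (matrix_inv P)) = transpose P"
    by (rule matrix_inv_eqI)+
qed

lemma mat_vector_mult: "mat k *v x = k *s (x :: 'a::semiring_1^'n)"
  by (simp add: vec_eq_iff matrix_vector_mult_def mat_def if_distrib if_distribR cong: if_cong)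

lemma mat_matrix_mult: "mat k ** A = (\<chi> i j. k * A $ i $ j)"
  by (simp add: vec_eq_iff matrix_matrix_mult_def mat_def if_distrib if_distribR cong: if_cong)

lemma matrix_mat_mult: "A ** mat k = (\<chi> i j. A $ i $ j * k)"
  by (simp add: vec_eq_iff matrix_matrix_mult_def mat_def if_distrib if_distribR cong: if_cong)

lemma mat_matrix_commute: "mat k ** A = A ** mat (k :: 'a::comm_semiring_1)"
  by (simp add: mat_matrix_mult matrix_mat_mult mult.commute)

lemma matrix_diff_ldistrib: "A ** (B - C) = A ** B - A ** (C :: 'a::ring_1^'n^'m)"
  by (simp add: vec_eq_iff matrix_matrix_mult_def sum_subtractf right_diff_distrib)

lemma matrix_diff_rdistrib: "(A - B) ** C = A ** C - B ** (C :: 'a::ring_1^'n^'m)"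
  by (simp add: vec_eq_iff matrix_matrix_mult_def sum_subtractf left_diff_distrib)

lemma poly_charpoly: "poly (charpoly M) z = det (mat z - M)"
proof -
  have "poly ((mat [:0, 1:] - map_matrix (\<lambda>a. [:a:]) M) $ i $ j) z = (mat z - M) $ i $ j" for i j
    by (simp add: mat_def)
  then show ?thesis
    by (simp only: charpoly_def det_def poly_sum poly_mult poly_prod of_int_poly poly_pCons poly_0
        mult_zero_right add_0_right)
qed

lemma mem_mat_spectrum_iff: "z \<in> mat_spectrum M \<longleftrightarrow> poly (charpoly M) z = 0"
proof -
  have "M *v v = z *s v \<longleftrightarrow> (mat z - M) *v v = 0" for v
    unfolding matrix_vector_mult_diff_rdistrib mat_vector_mult by auto
  then have "z \<in> mat_spectrum M \<longleftrightarrow> \<not> invertible (mat z - M)"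
    unfolding mat_spectrum_def invertible_left_inverse matrix_left_invertible_ker by auto
  then show ?thesis
    by (simp add: poly_charpoly invertible_det_nz)
qed

text \<open>In the Leibniz expansion the diagonal entries are linear and the others constant, so the
  term of a permutation has degree at most its number of fixed points. Only the identity reaches
  \<open>CARD('n)\<close>, with a product of monic linear factors.\<close>

lemma charpoly_degree_and_coeff:
  fixes M :: "complex^'n^'n"
  shows "degree (charpoly M) \<le> CARD('n)" "coeff (charpoly M) CARD('n) = 1"
proof -
  let ?B = "mat [:0, 1:] - map_matrix (\<lambda>a. [:a:]) M :: complex poly^'n^'n"
  let ?T = "\<lambda>p. \<Prod>i\<in>UNIV. ?B $ i $ p i"
  have B: "?B $ i $ j = (if i = j then [:- (M $ i $ j), 1:] else [:- (M $ i $ j):])" for i j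
    by (simp add: mat_def)
  have degB: "degree (?B $ i $ j) = (if i = j then 1 else 0)" for i j
    unfolding B by simp
  have deg: "degree (?T p) \<le> card {i. i = p i}" for p
  proof -
    have "degree (?T p) \<le> (\<Sum>i\<in>UNIV. degree (?B $ i $ p i))"
      using degree_prod_sum_le[of UNIV "\<lambda>i. ?B $ i $ p i"] by (simp add: o_def)
    also have "\<dots> = card {i. i = p i}"
      unfolding degB by (simp add: sum.If_cases)
    finally show ?thesis .
  qed
  have cardle: "card {i::'n. i = p i} \<le> CARD('n)" for p
    by (intro card_mono) auto
  have sgn: "degree (of_int (sign p) * ?T p) \<le> card {i. i = p i}" for p :: "'n \<Rightarrow> 'n"
    using deg[of p] by (cases p rule: sign_cases) auto
  show "degree (charpoly M) \<le> CARD('n)"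
    unfolding charpoly_def det_def
    by (intro degree_sum_le order_trans[OF sgn cardle]) (simp add: finite_permutations)
  have Tid: "?T id = (\<Prod>i\<in>UNIV. [:- (M $ i $ i), 1:])"
    unfolding B by simp
  have monic: "coeff (?T id) CARD('n) = 1"
  proof -
    have "degree (?T id) = (\<Sum>i\<in>(UNIV :: 'n set). 1)"
      unfolding Tid by (subst degree_prod_sum_eq) auto
    moreover have "lead_coeff (?T id) = 1"
      unfolding Tid lead_coeff_prod by (intro prod.neutral) simp
    ultimately show ?thesis by simp
  qed
  have T0: "coeff (of_int (sign p) * ?T p) CARD('n) = (if p = id then 1 else 0)" for p :: "'n \<Rightarrow> 'n"
  proof (cases "p = id")
    case True
    then show ?thesis using monic by (simp only: sign_id of_int_1 mult_1 simp_thms if_True)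
  next
    case False
    then obtain i where "i \<noteq> p i" by (metis id_apply ext)
    then have "card {i. i = p i} < CARD('n)"
      by (intro psubset_card_mono) auto
    then have "degree (of_int (sign p) * ?T p) < CARD('n)"
      using sgn[of p] by (rule le_less_trans[rotated])
    then show ?thesis
      using False by (simp only: coeff_eq_0 if_False)
  qed
  have "coeff (charpoly M) CARD('n)
      = (\<Sum>p | p permutes (UNIV :: 'n set). if p = id then 1 else 0)"
    unfolding charpoly_def det_def coeff_sum T0 ..
  then show "coeff (charpoly M) CARD('n) = 1"
    by (simp add: finite_permutations permutes_id)
qed

lemma charpoly_degree [simp]: "degree (charpoly (M :: complex^'n^'n)) = CARD('n)"
  using charpoly_degree_and_coeff[of M] by (metis le_antisym le_degree zero_neq_one)

lemma charpoly_monic: "lead_coeff (charpoly (M :: complex^'n^'n)) = 1"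
  using charpoly_degree_and_coeff(2)[of M] by simp

lemma charpoly_nonzero: "charpoly (M :: complex^'n^'n) \<noteq> 0"
  using charpoly_monic[of M] by force

section \<open>Roots of monic polynomials with parameters\<close>

text \<open>The modulus of a monic polynomial at \<open>z\<close> is the product of the distances
  from \<open>z\<close> to its roots, counted with multiplicity. If all of them were at least
  \<open>e\<close>, it would be at least \<open>e ^ degree q\<close>.\<close>

lemma monic_root_near:
  fixes q :: "complex poly"
  assumes "lead_coeff q = 1" and "norm (poly q z) < e ^ degree q" and "e > 0"
  shows "\<exists>w. poly q w = 0 \<and> dist w z < e"
proof (rule ccontr)
  assume far: "\<not> ?thesis"
  have q0: "q \<noteq> 0" using assms(1) by force
  let ?R = "proots q"
  have q: "q = (\<Prod>x\<in>#?R. [:-x, 1:])"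
    using complex_poly_decompose_multiset[of q] assms(1) by simp
  have "e ^ size R \<le> norm (poly (\<Prod>x\<in>#R. [:-x, 1:]) z)" if "\<forall>x\<in>#R. e \<le> norm (z - x)" for R
    using that
  proof (induction R)
    case (add x R)
    then have "e * e ^ size R \<le> norm (z - x) * norm (poly (\<Prod>x\<in>#R. [:-x, 1:]) z)"
      using assms(3) by (intro mult_mono) auto
    then show ?case by (simp add: norm_mult[symmetric] algebra_simps)
  qed simp
  moreover have "\<forall>x\<in>#?R. e \<le> norm (z - x)"
    using far q0 by (auto simp: dist_norm norm_minus_commute not_less)
  ultimately have "e ^ size ?R \<le> norm (poly q z)"
    using q by metis
  moreover have "size ?R = degree q"
    using size_proots_complex by blast
  ultimately show False using assms(2) by simp
qed

text \<open>\<open>CARD('p)\<close> distinct roots already fill the degree: the number of roots, the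
  sum of their orders and the degree coincide, which excludes further roots and forces every order
  to be 1.\<close>

lemma poly_eq_prod_roots:
  fixes q :: "complex poly" and mu :: "'p::finite \<Rightarrow> complex"
  assumes monic: "lead_coeff q = 1" and deg: "degree q = CARD('p)"
    and inj: "inj mu" and roots: "\<And>i. poly q (mu i) = 0"
  shows "q = (\<Prod>i\<in>UNIV. [:- mu i, 1:])" "\<And>i. order (mu i) q = 1" "{z. poly q z = 0} = range mu"
proof -
  have q0: "q \<noteq> 0" using monic by force
  have fin: "finite {z. poly q z = 0}" using q0 poly_roots_finite by blast
  have pos: "order z q \<ge> 1" if "poly q z = 0" for z
    using that q0 order_gt_0_iff[of q z] by simp
  have "card (range mu) = CARD('p)" using inj by (simp add: card_image)
  moreover have "card {z. poly q z = 0} \<le> (\<Sum>z | poly q z = 0. order z q)"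
    using sum_mono[of "{z. poly q z = 0}" "\<lambda>_. 1" "\<lambda>z. order z q"] pos by simp
  moreover have sumle: "(\<Sum>z | poly q z = 0. order z q) \<le> CARD('p)"
    using sum_order_le_degree[OF q0] deg by simp
  moreover have sub: "range mu \<subseteq> {z. poly q z = 0}" using roots by auto
  ultimately show eq: "{z. poly q z = 0} = range mu"
    using card_seteq[OF fin sub] by simp
  have ord: "order (mu i) q = 1" for i
  proof (rule ccontr)
    assume "order (mu i) q \<noteq> 1"
    then have "1 < order (mu i) q" using pos[OF roots[of i]] by simp
    then have "(\<Sum>z | poly q z = 0. 1) < (\<Sum>z | poly q z = 0. order z q)"
      using pos roots[of i] by (intro sum_strict_mono_ex1[OF fin]) auto
    then show False
      using sumle eq \<open>card (range mu) = CARD('p)\<close> by simp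
  qed
  then show "order (mu i) q = 1" for i .
  have "q = (\<Prod>z | poly q z = 0. [:-z, 1:] ^ order z q)"
    using complex_poly_decompose[of q] monic by simp
  also have "\<dots> = (\<Prod>i\<in>UNIV. [:- mu i, 1:])"
    unfolding eq using inj ord by (subst prod.reindex) auto
  finally show "q = (\<Prod>i\<in>UNIV. [:- mu i, 1:])" .
qed

text \<open>The filter is \<open>nhds\<close> rather than \<open>at\<close>, so that Landau bounds
  built from this one also cover the point \<open>x\<close> itself.\<close>

lemma continuous_at_imp_bigo_1:
  fixes f :: "'a::t2_space \<Rightarrow> 'b::real_normed_field"
  assumes "isCont f x"
  shows "f \<in> O[nhds x](\<lambda>_. 1)"
  using assms by (intro bigoI_tendsto[where c = "f x"]) (auto simp: isCont_def tendsto_nhds_iff)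

text \<open>The discs of radius \<open>e\<close> about the distinct roots \<open>lam $ i\<close> are
  disjoint. Near \<open>x0\<close> each still contains a root, and since the degree is
  \<open>CARD('p)\<close>, exactly one; this root is the label. Continuity comes from
  \<open>monic_root_near\<close> once more, applied at a chosen root with a smaller radius.\<close>

lemma ex_continuous_root_labelling:
  fixes q :: "'a::t2_space \<Rightarrow> complex poly" and lam :: "complex^'p"
  assumes W: "open W" "x0 \<in> W"
    and monic: "\<And>x. lead_coeff (q x) = 1" and deg: "\<And>x. degree (q x) = CARD('p)"
    and cont: "\<And>z. continuous_on W (\<lambda>x. poly (q x) z)"
    and inj: "inj (\<lambda>i. lam $ i)" and roots: "\<And>i. poly (q x0) (lam $ i) = 0"
  shows "\<exists>Z G. open Z \<and> x0 \<in> Z \<and> Z \<subseteq> W \<and> continuous_on Z G \<and> G x0 = lam \<and>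
    (\<forall>x\<in>Z. inj (\<lambda>i. G x $ i) \<and> (\<forall>i. poly (q x) (G x $ i) = 0))"
proof -
  obtain e where e: "e > 0" and sep: "\<And>i j. i \<noteq> j \<Longrightarrow> 2 * e \<le> dist (lam $ i) (lam $ j)"
  proof
    \<comment> \<open>The element 1 keeps the minimum defined when \<open>'p\<close> has a single
      index and there are no pairs.\<close>
    let ?D = "insert 1 ((\<lambda>(i, j). dist (lam $ i) (lam $ j)) ` {(i, j). i \<noteq> j})"
    have fin: "finite ?D" by simp
    show "Min ?D / 2 > 0"
      using fin inj by (subst half_gt_zero_iff, subst Min_gr_iff) (auto simp: inj_eq)
    show "2 * (Min ?D / 2) \<le> dist (lam $ i) (lam $ j)" if "i \<noteq> j" for i j
    proof -
      have "Min ?D \<le> dist (lam $ i) (lam $ j)"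
        using fin that by (intro Min_le) force+
      then show ?thesis by simp
    qed
  qed
  define Z where "Z = W \<inter> (\<Inter>i. {x \<in> W. norm (poly (q x) (lam $ i)) < e ^ CARD('p)})"
  have opn: "open {x \<in> V. norm (poly (q x) z) < c}" if "open V" "V \<subseteq> W" for V z c
  proof -
    have "open (V \<inter> (\<lambda>x. norm (poly (q x) z)) -` {..<c})"
      using that by (intro continuous_open_preimage continuous_on_norm
          continuous_on_subset[OF cont]) auto
    then show ?thesis by (simp add: vimage_def Collect_conj_eq)
  qed
  have "open Z"
    unfolding Z_def by (intro open_Int open_INT ballI opn W(1) order.refl finite)
  have "x0 \<in> Z" "Z \<subseteq> W"
    using W(2) e by (auto simp: Z_def roots)
  have exroot: "\<exists>z. poly (q x) z = 0 \<and> dist z (lam $ i) < e" if "x \<in> Z" for x i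
    using that e monic by (intro monic_root_near) (auto simp: Z_def deg)
  define G where "G x = (\<chi> i. SOME z. poly (q x) z = 0 \<and> dist z (lam $ i) < e)" for x
  have G: "poly (q x) (G x $ i) = 0" "dist (G x $ i) (lam $ i) < e" if "x \<in> Z" for x i
    using someI_ex[OF exroot[OF that, of i]] by (simp_all add: G_def)
  have injG: "inj (\<lambda>i. G x $ i)" if x: "x \<in> Z" for x
  proof (rule injI)
    fix i j assume "G x $ i = G x $ j"
    then have "dist (lam $ i) (lam $ j) < 2 * e"
      using dist_triangle_less_add[of "lam $ i" "G x $ i" e "lam $ j" e] G(2)[OF x, of i] G(2)[OF x, of j]
      by (simp add: dist_commute)
    then show "i = j" using sep[of i j] by linarith
  qed
  \<comment> \<open>A root in the disc about \<open>lam $ i\<close> is some \<open>G x $ j\<close>,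
    hence also within \<open>e\<close> of \<open>lam $ j\<close>, and the separation forces
    \<open>j = i\<close>.\<close>
  have uniq: "z = G x $ i" if x: "x \<in> Z" and z: "poly (q x) z = 0" "dist z (lam $ i) < e" for x z i
  proof -
    have "{z. poly (q x) z = 0} = range (\<lambda>i. G x $ i)"
      by (rule poly_eq_prod_roots(3)[OF monic deg injG[OF x] G(1)[OF x]])
    with z(1) obtain j where j: "z = G x $ j" by blast
    have "dist (lam $ i) (lam $ j) < 2 * e"
      using dist_triangle_less_add[of "lam $ i" z e "lam $ j" e] G(2)[OF x, of j] z(2) j
      by (simp add: dist_commute)
    then show ?thesis using sep[of i j] j by fastforce
  qed
  have "((\<lambda>x. G x $ i) \<longlongrightarrow> G y $ i) (at y)" if y: "y \<in> Z" for y i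
  proof (rule tendstoI)
    fix r :: real assume r: "r > 0"
    \<comment> \<open>A root this close to \<open>G y $ i\<close> still lies in the disc about
      \<open>lam $ i\<close>, so by \<open>uniq\<close> it is \<open>G x $ i\<close>.\<close>
    let ?r = "min r (e - dist (G y $ i) (lam $ i))"
    have rpos: "?r > 0" using r G(2)[OF y, of i] by simp
    let ?U = "{x \<in> Z. norm (poly (q x) (G y $ i)) < ?r ^ CARD('p)}"
    have "open ?U" using opn[OF \<open>open Z\<close> \<open>Z \<subseteq> W\<close>] .
    moreover have "y \<in> ?U" using y G(1)[OF y] rpos by simp
    ultimately have "\<forall>\<^sub>F x in at y. x \<in> ?U"
      by (rule eventually_at_in_open')
    then show "\<forall>\<^sub>F x in at y. dist (G x $ i) (G y $ i) < r"
    proof eventually_elim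
      case (elim x)
      then have x: "x \<in> Z" by simp
      have "norm (poly (q x) (G y $ i)) < ?r ^ degree (q x)" using elim by (simp add: deg)
      then obtain z where z: "poly (q x) z = 0" "dist z (G y $ i) < ?r"
        using monic_root_near[OF monic _ rpos] by blast
      have "dist z (lam $ i) < e"
        using dist_triangle[of z "lam $ i" "G y $ i"] z(2) by linarith
      then have "z = G x $ i" using uniq[OF x z(1)] by blast
      then show ?case using z(2) by simp
    qed
  qed
  then have "continuous_on Z G"
    unfolding continuous_on_eq_continuous_at[OF \<open>open Z\<close>] isCont_def by (blast intro: vec_tendstoI)
  moreover have "G x0 $ i = lam $ i" for i
    using uniq[OF \<open>x0 \<in> Z\<close> roots[of i], of i] e by simp
  then have "G x0 = lam"
    by (simp add: vec_eq_iff)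
  ultimately show ?thesis
    using \<open>open Z\<close> \<open>x0 \<in> Z\<close> \<open>Z \<subseteq> W\<close> injG G(1) by blast
qed

text \<open>\<open>r\<close> will be the value of a monic polynomial at the unperturbed root
  \<open>G x0 $ i\<close>. The factors with index other than \<open>i\<close> have nonzero limits
  because the labels are distinct at \<open>x0\<close>, so their product has a bounded inverse and
  the factor \<open>i\<close> alone carries the smallness of \<open>r\<close>.\<close>

lemma root_labelling_bigo:
  fixes G :: "'a::t2_space \<Rightarrow> complex^'p" and g :: "'a \<Rightarrow> complex"
  assumes cont: "isCont G x0" and inj: "inj (\<lambda>i. G x0 $ i)"
    and prod: "\<forall>\<^sub>F x in nhds x0. r x = (\<Prod>j\<in>UNIV. G x0 $ i - G x $ j)"
    and r: "r \<in> O[nhds x0](g)"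
  shows "(\<lambda>x. G x $ i - G x0 $ i) \<in> O[nhds x0](g)"
proof -
  let ?h = "\<lambda>x. \<Prod>j\<in>-{i}. G x0 $ i - G x $ j"
  have cont_h: "isCont ?h x0"
    by (intro continuous_intros cont)
  have h0: "?h x0 \<noteq> 0"
    using inj by (auto simp: inj_eq)
  have "isCont (\<lambda>x. inverse (?h x)) x0"
    by (rule continuous_at_within_inverse[OF cont_h h0])
  then have "(\<lambda>x. inverse (?h x)) \<in> O[nhds x0](\<lambda>_. 1)"
    by (rule continuous_at_imp_bigo_1)
  with r have "(\<lambda>x. r x * inverse (?h x)) \<in> O[nhds x0](\<lambda>x. g x * 1)"
    by (rule landau_o.big.mult)
  moreover have "\<forall>\<^sub>F x in nhds x0. ?h x \<noteq> 0"
    using cont_h h0 tendsto_imp_eventually_ne[of ?h "?h x0" "nhds x0" 0]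
    unfolding isCont_def tendsto_nhds_iff by blast
  with prod have "\<forall>\<^sub>F x in nhds x0. r x * inverse (?h x) = G x0 $ i - G x $ i"
  proof eventually_elim
    case (elim x)
    have "r x = (G x0 $ i - G x $ i) * ?h x"
      using elim(1) prod.remove[of UNIV i "\<lambda>j. G x0 $ i - G x $ j"] by (simp add: Compl_eq_Diff_UNIV)
    then show ?case using elim(2) by simp
  qed
  ultimately have "(\<lambda>x. G x0 $ i - G x $ i) \<in> O[nhds x0](g)"
    by (simp add: landau_o.big.in_cong)
  then have "(\<lambda>x. - (G x0 $ i - G x $ i)) \<in> O[nhds x0](g)"
    by (simp only: landau_o.big.uminus_in_iff)
  then show ?thesis by simp
qed

section \<open>Second-order smallness and quadratic convergence\<close>

text \<open>In the Leibniz expansion a permutation fixing \<open>i\<close> picks the second-order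
  diagonal entry. Any other one picks an entry of row \<open>i\<close> and a different entry of
  column \<open>i\<close>, each of first order. The remaining factors are bounded.\<close>

lemma det_bigo_square:
  fixes B :: "'a \<Rightarrow> complex^'p^'p" and g :: "'a \<Rightarrow> complex"
  assumes diag: "(\<lambda>x. B x $ i $ i) \<in> O[F](\<lambda>x. g x ^ 2)"
    and row: "\<And>l. l \<noteq> i \<Longrightarrow> (\<lambda>x. B x $ i $ l) \<in> O[F](g)"
    and col: "\<And>k. k \<noteq> i \<Longrightarrow> (\<lambda>x. B x $ k $ i) \<in> O[F](g)"
    and bdd: "\<And>k l. (\<lambda>x. B x $ k $ l) \<in> O[F](\<lambda>_. 1)"
  shows "(\<lambda>x. det (B x)) \<in> O[F](\<lambda>x. g x ^ 2)"
  unfolding det_def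
proof (rule big_sum_in_bigo)
  fix p assume "p \<in> {p. p permutes (UNIV :: 'p set)}"
  then have p: "p permutes UNIV" by simp
  have bdd': "(\<lambda>x. \<Prod>k\<in>T. B x $ k $ p k) \<in> O[F](\<lambda>_. 1)" for T
    by (intro landau_o.big_prod_in_1 bdd)
  have "(\<lambda>x. \<Prod>k\<in>UNIV. B x $ k $ p k) \<in> O[F](\<lambda>x. g x ^ 2)"
  proof (cases "p i = i")
    case True
    have "(\<lambda>x. B x $ i $ p i * (\<Prod>k\<in>UNIV - {i}. B x $ k $ p k)) \<in> O[F](\<lambda>x. g x ^ 2 * 1)"
      using True diag by (intro landau_o.big.mult bdd') simp
    then show ?thesis
      by (subst prod.remove[of UNIV i]) auto
  next
    case False
    obtain k where k: "p k = i"
      using permutes_surj[OF p] by (metis surjD)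
    with False have ki: "k \<noteq> i" by auto
    have "(\<lambda>x. B x $ i $ p i * (B x $ k $ p k * (\<Prod>k\<in>UNIV - {i} - {k}. B x $ k $ p k)))
        \<in> O[F](\<lambda>x. g x * (g x * 1))"
      using False k col[OF ki] row[of "p i"] by (intro landau_o.big.mult bdd') auto
    then show ?thesis
      using ki by (subst prod.remove[of UNIV i], simp, simp, subst prod.remove[of _ k])
        (auto simp: power2_eq_square)
  qed
  then show "(\<lambda>x. of_int (sign p) * (\<Prod>k\<in>UNIV. B x $ k $ p k)) \<in> O[F](\<lambda>x. g x ^ 2)"
    by (simp add: sign_nz)
qed

text \<open>Close to \<open>L\<close> the quadratic bound makes \<open>G\<close> at least halve the
  distance to \<open>L\<close>, so the iterates stay in the ball where the bound holds and converge
  geometrically.\<close>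

lemma iteration_converges_quadratically_near:
  fixes L :: "'a::real_normed_vector"
  assumes "open Z" and "L \<in> Z"
    and quad: "\<forall>\<^sub>F S in nhds L. norm (G S - L) \<le> C * (norm (S - L))\<^sup>2"
  shows "\<exists>V. open V \<and> L \<in> V \<and> (\<forall>S0\<in>V. iteration_converges_quadratically Z G S0 L)"
proof -
  have "\<forall>\<^sub>F S in nhds L. S \<in> Z \<and> norm (G S - L) \<le> C * (norm (S - L))\<^sup>2"
    using eventually_nhds_in_open[OF assms(1,2)] quad by eventually_elim simp
  then obtain e where e: "e > 0"
    and near: "\<And>S. dist S L < e \<Longrightarrow> S \<in> Z \<and> norm (G S - L) \<le> C * (norm (S - L))\<^sup>2"
    unfolding eventually_nhds_metric by blast
  \<comment> \<open>Adding 1 to the modulus keeps the denominator positive for every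
    \<open>C\<close>; on the ball, \<open>C\<close> times the distance to \<open>L\<close> is at
    most 1/2.\<close>
  define r where "r = min e (1 / (2 * (\<bar>C\<bar> + 1)))"
  have r: "r > 0" "r \<le> e" "(\<bar>C\<bar> + 1) * r \<le> 1 / 2"
  proof -
    show "r > 0" "r \<le> e" using e by (auto simp: r_def)
    have "(\<bar>C\<bar> + 1) * r \<le> (\<bar>C\<bar> + 1) * (1 / (2 * (\<bar>C\<bar> + 1)))"
      by (intro mult_left_mono) (auto simp: r_def)
    also have "\<dots> = 1 / 2" by (simp add: field_simps)
    finally show "(\<bar>C\<bar> + 1) * r \<le> 1 / 2" .
  qed
  have half: "norm (G S - L) \<le> norm (S - L) / 2" if "norm (S - L) < r" for S
  proof -
    have "norm (G S - L) \<le> C * (norm (S - L))\<^sup>2"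
      using near[of S] that r by (simp add: dist_norm)
    also have "\<dots> \<le> ((\<bar>C\<bar> + 1) * r) * norm (S - L)"
      unfolding power2_eq_square mult.assoc[symmetric]
      using that by (intro mult_right_mono mult_mono) auto
    also have "\<dots> \<le> 1 / 2 * norm (S - L)"
      using r(3) by (intro mult_right_mono) auto
    finally show ?thesis by simp
  qed
  have "iteration_converges_quadratically Z G S0 L" if S0: "S0 \<in> ball L r" for S0
  proof -
    have S0': "norm (S0 - L) < r" using S0 by (simp add: dist_norm norm_minus_commute)
    have bound: "norm ((G ^^ k) S0 - L) \<le> norm (S0 - L) * (1 / 2) ^ k" for k
    proof (induction k)
      case (Suc k)
      have "norm (S0 - L) * (1 / 2) ^ k \<le> norm (S0 - L) * 1"
        by (intro mult_left_mono power_le_one) auto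
      with Suc S0' have "norm ((G ^^ k) S0 - L) < r" by simp
      from half[OF this] Suc show ?case by simp
    qed simp
    have inr: "norm ((G ^^ k) S0 - L) < r" for k
    proof -
      have "norm (S0 - L) * (1 / 2) ^ k \<le> norm (S0 - L) * 1"
        by (intro mult_left_mono power_le_one) auto
      with bound[of k] S0' show ?thesis by simp
    qed
    have "(\<lambda>k. norm (S0 - L) * (1 / 2) ^ k) \<longlonglongrightarrow> norm (S0 - L) * 0"
      by (intro tendsto_mult_left LIMSEQ_realpow_zero) auto
    then have lim0: "(\<lambda>k. norm (S0 - L) * (1 / 2) ^ k) \<longlonglongrightarrow> 0"
      by (simp only: mult_zero_right)
    have "\<forall>\<^sub>F k in sequentially. norm ((G ^^ k) S0 - L) \<le> norm (S0 - L) * (1 / 2) ^ k"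
      by (rule always_eventually) (use bound in blast)
    from Lim_null_comparison[OF this lim0] have "(\<lambda>k. (G ^^ k) S0) \<longlonglongrightarrow> L"
      by (rule LIM_zero_cancel)
    moreover have "(G ^^ k) S0 \<in> Z \<and> norm ((G ^^ Suc k) S0 - L) \<le> C * (norm ((G ^^ k) S0 - L))\<^sup>2" for k
      using near[of "(G ^^ k) S0"] inr[of k] r(2) by (simp add: dist_norm)
    ultimately show ?thesis
      unfolding iteration_converges_quadratically_def by blast
  qed
  then show ?thesis
    using r(1) by (intro exI[of _ "ball L r"]) auto
qed

section \<open>Normalised partial fractions\<close>

text \<open>The data of a partial fraction sum with distinct poles, nonzero coefficients and no
  zeros off the poles. The sum will be the transfer function.\<close>

locale pole_data =
  fixes d w :: "'n::finite \<Rightarrow> complex"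
  assumes inj_d: "inj d" and w_nonzero: "w j \<noteq> 0"
    and transfer_nonzero: "s \<notin> range d \<Longrightarrow> (\<Sum>j\<in>UNIV. w j / (d j - s)) \<noteq> 0"
begin

definition cofac :: "'n \<Rightarrow> complex \<Rightarrow> complex"
  where "cofac j s = (\<Prod>i\<in>-{j}. d i - s)"

definition numer :: "complex \<Rightarrow> complex"
  where "numer s = (\<Sum>j\<in>UNIV. w j * cofac j s)"

text \<open>Extends the quotient of \<open>1 / (d j - s)\<close> by the partial fraction sum to the
  poles: multiplying both by the product of all \<open>d i - s\<close> turns them into the
  polynomials \<open>cofac j\<close> and \<open>numer\<close>.\<close>

definition phi :: "'n \<Rightarrow> complex \<Rightarrow> complex"
  where "phi j s = cofac j s / numer s"

lemma cofac_pole: "cofac j (d k) = 0 \<longleftrightarrow> j \<noteq> k"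
  using inj_d by (auto simp: cofac_def inj_eq)

lemma numer_pole: "numer (d k) = w k * cofac k (d k)"
proof -
  have "numer (d k) = (\<Sum>j\<in>UNIV. if j = k then w k * cofac k (d k) else 0)"
    unfolding numer_def using cofac_pole by (intro sum.cong) auto
  then show ?thesis by simp
qed

lemma cofac_regular: "s \<notin> range d \<Longrightarrow> cofac j s = (\<Prod>i\<in>UNIV. d i - s) / (d j - s)"
  unfolding cofac_def by (subst prod.remove[of UNIV j]) (auto simp: Compl_eq_Diff_UNIV)

lemma numer_regular:
  "s \<notin> range d \<Longrightarrow> numer s = (\<Prod>i\<in>UNIV. d i - s) * (\<Sum>j\<in>UNIV. w j / (d j - s))"
  by (simp add: numer_def cofac_regular sum_distrib_left mult.commute mult.left_commute)

text \<open>At a pole a single nonzero summand survives; elsewhere \<open>numer\<close> is the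
  partial fraction sum times a nonzero product. Hence every \<open>phi j\<close> is continuous on
  the whole plane.\<close>

lemma numer_nonzero: "numer s \<noteq> 0"
proof (cases "s \<in> range d")
  case True
  then obtain k where "s = d k" by blast
  then show ?thesis using cofac_pole[of k k] w_nonzero by (simp add: numer_pole)
next
  case False
  then have "(\<Prod>i\<in>UNIV. d i - s) \<noteq> 0" by auto
  then show ?thesis using transfer_nonzero[OF False] by (simp add: numer_regular[OF False])
qed

lemma phi_pole: "phi j (d k) = (if j = k then 1 / w k else 0)"
  using cofac_pole[of j k] cofac_pole[of k k] w_nonzero[of k] by (auto simp: phi_def numer_pole)

lemma phi_regular:
  assumes "s \<notin> range d"
  shows "phi j s = inverse (\<Sum>j\<in>UNIV. w j / (d j - s)) * (1 / (d j - s))"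
proof -
  have "(\<Prod>i\<in>UNIV. d i - s) \<noteq> 0" "d j - s \<noteq> 0" using assms by auto
  then show ?thesis
    using transfer_nonzero[OF assms]
    by (simp add: phi_def cofac_regular[OF assms] numer_regular[OF assms] field_simps)
qed

lemma continuous_on_phi: "continuous_on UNIV (phi j)"
  unfolding phi_def cofac_def numer_def
  using numer_nonzero unfolding numer_def cofac_def by (intro continuous_intros) auto

text \<open>For \<open>j\<close> other than \<open>k\<close> the cofactor contains the factor
  \<open>d k - s\<close>; what remains is continuous, hence bounded near \<open>d k\<close>.\<close>

lemma phi_bigo:
  assumes "j \<noteq> k"
  shows "phi j \<in> O[nhds (d k)](\<lambda>s. s - d k)"
proof -
  let ?h = "\<lambda>s. (\<Prod>i\<in>-{j}-{k}. d i - s) / numer s"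
  have "continuous_on UNIV ?h"
    using numer_nonzero unfolding numer_def cofac_def by (intro continuous_intros) auto
  then have "isCont ?h (d k)"
    by (simp add: continuous_on_eq_continuous_at)
  then have "(\<lambda>s. (s - d k) * (- ?h s)) \<in> O[nhds (d k)](\<lambda>s. (s - d k) * 1)"
    by (intro landau_o.big.mult landau_o.big_refl continuous_at_imp_bigo_1 continuous_minus)
  moreover have "phi j s = (s - d k) * (- ?h s)" for s
  proof -
    have "cofac j s = (d k - s) * (\<Prod>i\<in>-{j}-{k}. d i - s)"
      unfolding cofac_def using assms by (subst prod.remove[of _ k]) auto
    then show ?thesis
      unfolding phi_def by (simp only:) (simp add: left_diff_distrib diff_divide_distrib)
  qed
  moreover from this have "phi j = (\<lambda>s. (s - d k) * (- ?h s))" by (rule ext)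
  ultimately show ?thesis by (simp only: mult_1_right)
qed

text \<open>One family covers all matrices that occur: weights 1 give \<open>Y^T X\<close>, weights
  \<open>d j\<close> give \<open>Y^T A X\<close>, and weights \<open>z - d j\<close> give
  \<open>Y^T (z I - A) X\<close>.\<close>

definition weighted_gram :: "('n \<Rightarrow> complex) \<Rightarrow> complex^'p \<Rightarrow> complex^'p^'p"
  where "weighted_gram v S = (\<chi> k l. \<Sum>j\<in>UNIV. v j * w j * phi j (S $ k) * phi j (S $ l))"

lemma continuous_weighted_gram:
  fixes k l :: "'p::finite"
  shows "continuous_on UNIV (\<lambda>S. weighted_gram v S $ k $ l)"
proof -
  have "continuous_on UNIV (\<lambda>S :: complex^'p. phi j (S $ k))" for j k
    by (rule continuous_on_compose2[OF continuous_on_phi]) (auto intro: continuous_intros)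
  then show ?thesis
    unfolding weighted_gram_def by (simp, intro continuous_intros)
qed

lemma continuous_det_weighted_gram: "continuous_on UNIV (\<lambda>S. det (weighted_gram v S))"
  unfolding det_def by (intro continuous_intros continuous_weighted_gram)

lemma det_weighted_gram_poles:
  assumes "inj a" and S: "\<And>k. S $ k = d (a k)"
  shows "det (weighted_gram v S) = (\<Prod>k\<in>UNIV. v (a k) / w (a k))"
proof -
  have *: "weighted_gram v S $ k $ l = (if k = l then v (a k) / w (a k) else 0)" for k l
  proof -
    have "weighted_gram v S $ k $ l
        = (\<Sum>j\<in>UNIV. if j = a k then (if k = l then v (a k) / w (a k) else 0) else 0)"
      using \<open>inj a\<close> w_nonzero[of "a k"]
      unfolding weighted_gram_def vec_lambda_beta by (intro sum.cong) (auto simp: S phi_pole inj_eq)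
    then show ?thesis by simp
  qed
  show ?thesis
    by (subst det_diagonal) (simp_all add: *)
qed

lemma phi_component_bigo:
  fixes S0 :: "complex^'p"
  assumes "S0 $ k = d m" "j \<noteq> m"
  shows "(\<lambda>S. phi j (S $ k)) \<in> O[nhds S0](\<lambda>S. of_real (norm (S - S0)))"
proof -
  have "filterlim (\<lambda>S. S $ k) (nhds (d m)) (nhds S0)"
    using tendsto_vec_nth[of "\<lambda>S. S" S0 "nhds S0" k] filterlim_ident[of "nhds S0"] assms(1) by simp
  from landau_o.big.compose[OF phi_bigo[OF assms(2)] this]
  have "(\<lambda>S. phi j (S $ k)) \<in> O[nhds S0](\<lambda>S. S $ k - d m)" .
  also have "(\<lambda>S. S $ k - d m) \<in> O[nhds S0](\<lambda>S. of_real (norm (S - S0)) :: complex)"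
  proof (rule bigoI[where c = 1], rule always_eventually, rule allI)
    fix S show "norm (S $ k - d m) \<le> 1 * norm (of_real (norm (S - S0)) :: complex)"
      using Finite_Cartesian_Product.norm_nth_le[where x = "S - S0" and i = k] assms(1) by simp
  qed
  finally show ?thesis .
qed

text \<open>At \<open>S0\<close> the only nonvanishing \<open>phi j (S $ i)\<close> is the one with
  \<open>j = a i\<close>, and its weight is 0. Every other summand in row or column \<open>i\<close>
  carries a factor of first order, and on the diagonal it carries two.\<close>

lemma det_weighted_gram_bigo:
  fixes S0 :: "complex^'p"
  assumes "inj a" and S0: "\<And>k. S0 $ k = d (a k)" and v: "v (a i) = 0"
  shows "(\<lambda>S. det (weighted_gram v S)) \<in> O[nhds S0](\<lambda>S. of_real (norm (S - S0)) ^ 2)"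
proof -
  \<comment> \<open>Both sides of a Landau bound take values in the same field, hence the cast of
    the norm to \<open>complex\<close>.\<close>
  let ?g = "\<lambda>S. of_real (norm (S - S0)) :: complex"
  have phi1: "(\<lambda>S. phi j (S $ k)) \<in> O[nhds S0](\<lambda>_. 1)" for j k
  proof (rule continuous_at_imp_bigo_1)
    show "isCont (\<lambda>S. phi j (S $ k)) S0"
      using continuous_on_compose2[OF continuous_on_phi, of UNIV "\<lambda>S. S $ k" j]
      by (simp add: continuous_on_eq_continuous_at continuous_on_component)
  qed
  have const: "(\<lambda>_. c) \<in> O[nhds S0](\<lambda>_. 1 :: complex)" for c :: complex
    by simp
  have phi_i: "(\<lambda>S. v j * w j * phi j (S $ i)) \<in> O[nhds S0](?g)" for j
  proof (cases "j = a i")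
    case False
    from landau_o.big.mult[OF const[of "v j * w j"] phi_component_bigo[of S0, OF S0 False]]
    show ?thesis by simp
  qed (simp add: v)
  show ?thesis
  proof (rule det_bigo_square)
    have "(\<lambda>S. v j * w j * phi j (S $ i) * phi j (S $ i)) \<in> O[nhds S0](\<lambda>S. ?g S ^ 2)" for j
    proof (cases "j = a i")
      case False
      from landau_o.big.mult[OF phi_i phi_component_bigo[of S0, OF S0 False]]
      show ?thesis by (simp add: power2_eq_square)
    qed (simp add: v)
    then show "(\<lambda>S. weighted_gram v S $ i $ i) \<in> O[nhds S0](\<lambda>S. ?g S ^ 2)"
      unfolding weighted_gram_def by (simp add: big_sum_in_bigo)
    have *: "(\<lambda>S. v j * w j * phi j (S $ i) * phi j (S $ k)) \<in> O[nhds S0](?g)" for j k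
      using landau_o.big.mult[OF phi_i phi1] by simp
    then show row: "(\<lambda>S. weighted_gram v S $ i $ k) \<in> O[nhds S0](?g)" for k
      unfolding weighted_gram_def by (simp add: big_sum_in_bigo)
    have "weighted_gram v S $ k $ i = weighted_gram v S $ i $ k" for S :: "complex^'p" and k
      by (simp add: weighted_gram_def mult_ac)
    then show "(\<lambda>S. weighted_gram v S $ k $ i) \<in> O[nhds S0](?g)" for k
      using row[of k] by simp
    show "(\<lambda>S. weighted_gram v S $ k $ l) \<in> O[nhds S0](\<lambda>_. 1)" for k l
      by (intro continuous_at_imp_bigo_1)
        (use continuous_weighted_gram in \<open>auto simp: continuous_on_eq_continuous_at\<close>)
  qed
qed

end

section \<open>The iteration in eigenbasis coordinates\<close>

lemma scalar_product_matrix_vector: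
  "scalar_product x (M *v y) = scalar_product (transpose M *v x) (y :: 'a::comm_semiring_1^'n)"
proof -
  have "scalar_product x (M *v y) = (\<Sum>i\<in>UNIV. \<Sum>j\<in>UNIV. x $ i * (M $ i $ j * y $ j))"
    by (simp add: scalar_product_def matrix_vector_mult_def sum_distrib_left)
  also have "\<dots> = (\<Sum>j\<in>UNIV. \<Sum>i\<in>UNIV. x $ i * (M $ i $ j * y $ j))"
    by (rule sum.swap)
  also have "\<dots> = scalar_product (transpose M *v x) y"
    by (simp add: scalar_product_def matrix_vector_mult_def transpose_def sum_distrib_left mult_ac)
  finally show ?thesis .
qed

lemma scalar_product_commute: "scalar_product x y = scalar_product y (x :: 'a::comm_semiring_1^'n)"
  by (simp add: scalar_product_def mult.commute)

lemma scalar_product_axis: "scalar_product x (axis k 1) = x $ k"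
  by (simp add: scalar_product_def axis_def if_distrib cong: if_cong)

lemma diagonal_mat_mult_vector:
  assumes "diagonal_mat D"
  shows "D *v x = (\<chi> j. D $ j $ j * x $ j)"
proof -
  have "(\<Sum>j\<in>UNIV. D $ i $ j * x $ j) = (\<Sum>j\<in>UNIV. if j = i then D $ i $ i * x $ i else 0)" for i
    using assms by (intro sum.cong) (auto simp: diagonal_mat_def)
  then show ?thesis by (simp add: matrix_vector_mult_def)
qed

lemma transpose_diagonal_mat: "diagonal_mat D \<Longrightarrow> transpose D = D"
  by (auto simp: diagonal_mat_def transpose_def vec_eq_iff) metis

lemma charpoly_diagonalized:
  fixes P D :: "complex^'n^'n"
  assumes "invertible P" "diagonal_mat D"
  shows "charpoly (P ** D ** matrix_inv P) = (\<Prod>j\<in>UNIV. [:- (D $ j $ j), 1:])"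
proof (rule poly_eq_poly_eq_iff[THEN iffD1], rule ext)
  fix z
  have "P ** mat z ** matrix_inv P = mat z ** (P ** matrix_inv P)"
    by (simp only: mat_matrix_commute[of z P] matrix_mul_assoc)
  then have "mat z - P ** D ** matrix_inv P = P ** (mat z - D) ** matrix_inv P"
    by (simp add: matrix_diff_ldistrib matrix_diff_rdistrib matrix_inv_mult(1)[OF assms(1)])
  moreover have "det P * det (matrix_inv P) = 1"
    by (metis det_mul det_I matrix_inv_mult(1)[OF assms(1)])
  ultimately have "poly (charpoly (P ** D ** matrix_inv P)) z = det (mat z - D)"
    by (simp add: poly_charpoly det_mul)
  also have "\<dots> = (\<Prod>j\<in>UNIV. z - D $ j $ j)"
    using assms(2) by (subst det_diagonal) (auto simp: mat_def diagonal_mat_def)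
  finally show "poly (charpoly (P ** D ** matrix_inv P)) z = poly (\<Prod>j\<in>UNIV. [:- (D $ j $ j), 1:]) z"
    by (simp add: poly_prod)
qed

lemma mat_spectrum_diagonalized:
  fixes P D :: "complex^'n^'n"
  assumes "invertible P" "diagonal_mat D"
  shows "mat_spectrum (P ** D ** matrix_inv P) = range (\<lambda>j. D $ j $ j)"
  by (auto simp: mem_mat_spectrum_iff charpoly_diagonalized[OF assms] poly_prod)

text \<open>A repeated diagonal entry would make the square of its linear factor divide the
  characteristic polynomial, giving an eigenvalue of order at least 2.\<close>

lemma inj_diagonal_of_simple:
  fixes P D :: "complex^'n^'n"
  assumes "invertible P" "diagonal_mat D"
    and simple: "\<And>z. z \<in> mat_spectrum (P ** D ** matrix_inv P) \<Longrightarrow> simple_eigenvalue (P ** D ** matrix_inv P) z"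
  shows "inj (\<lambda>j. D $ j $ j)"
proof (rule injI, rule ccontr)
  fix j k assume eq: "D $ j $ j = D $ k $ k" and "j \<noteq> k"
  let ?q = "charpoly (P ** D ** matrix_inv P)" and ?f = "\<lambda>j. [:- (D $ j $ j), 1:]"
  have "?q = ?f k * (?f j * (\<Prod>i\<in>UNIV - {k} - {j}. ?f i))"
    unfolding charpoly_diagonalized[OF assms(1,2)]
    using \<open>j \<noteq> k\<close> by (subst prod.remove[of UNIV k], simp, simp, subst prod.remove[of _ j]) auto
  then have "?q = ?f k ^ 2 * (\<Prod>i\<in>UNIV - {k} - {j}. ?f i)"
    by (simp only: eq power2_eq_square mult.assoc)
  then have "?f k ^ 2 dvd ?q"
    by (rule dvdI)
  then have "2 \<le> order (D $ k $ k) ?q"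
    using charpoly_nonzero order_divides by blast
  moreover have "order (D $ k $ k) ?q = 1"
    using simple[of "D $ k $ k"] mat_spectrum_diagonalized[OF assms(1,2)]
    by (auto simp: simple_eigenvalue_def)
  ultimately show False by simp
qed

text \<open>The assumptions are stable under transposing \<open>A\<close> while exchanging
  \<open>b\<close> with \<open>c\<close> and replacing \<open>P\<close> by its inverse transpose, so
  results on \<open>dpse_f\<close> carry over to \<open>dpse_g\<close>.\<close>

locale diagonalized_system =
  fixes A P D :: "complex^'n^'n" and b c :: "complex^'n"
  assumes invertible_P: "invertible P" and diagonal_D: "diagonal_mat D"
    and A_eq: "A = P ** D ** matrix_inv P"
    and inj_diag: "inj (\<lambda>j. D $ j $ j)"
    and transfer_function_nonzero: "s \<notin> mat_spectrum A \<Longrightarrow> transfer_function A b c s \<noteq> 0"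
    and residue_nonzero: "scalar_product c (P *v axis k 1) *
      scalar_product (axis k 1) (matrix_inv P *v b) \<noteq> 0"
begin

abbreviation diag :: "'n \<Rightarrow> complex" where "diag j \<equiv> D $ j $ j"

definition beta :: "complex^'n" where "beta = matrix_inv P *v b"
definition gamma :: "complex^'n" where "gamma = transpose P *v c"

lemma spectrum_A: "mat_spectrum A = range diag"
  unfolding A_eq using invertible_P diagonal_D by (rule mat_spectrum_diagonalized)

lemma gamma_component: "scalar_product c (P *v axis k 1) = gamma $ k"
  unfolding gamma_def scalar_product_matrix_vector scalar_product_axis ..

lemma beta_component: "scalar_product (axis k 1) (matrix_inv P *v b) = beta $ k"
  unfolding beta_def scalar_product_commute[of "axis k 1"] scalar_product_axis ..

definition residue :: "'n \<Rightarrow> complex" where "residue j = gamma $ j * beta $ j"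

lemma gamma_beta_nonzero: "gamma $ k * beta $ k \<noteq> 0"
  using residue_nonzero[of k] unfolding gamma_component beta_component .

lemma invertible_regular:
  assumes "s \<notin> range diag"
  shows "invertible (A - mat s)"
proof -
  have "\<forall>v. (A - mat s) *v v = 0 \<longrightarrow> v = 0"
    using assms spectrum_A unfolding mat_spectrum_def
    by (auto simp: matrix_vector_mult_diff_rdistrib mat_vector_mult)
  then show ?thesis
    unfolding invertible_left_inverse matrix_left_invertible_ker .
qed

lemma resolvent_mult:
  assumes "s \<notin> range diag"
  shows "resolvent A s *v b = P *v (\<chi> j. beta $ j / (diag j - s))"
proof -
  let ?x = "\<chi> j. beta $ j / (diag j - s)"
  have nz: "diag j - s \<noteq> 0" for j using assms by auto
  have inv: "invertible (A - mat s)"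
    using assms by (rule invertible_regular)
  have AP: "A ** P = P ** D"
    by (simp only: A_eq matrix_mul_assoc[symmetric] matrix_inv_mult(2)[OF invertible_P] matrix_mul_rid)
  have "(A - mat s) *v (P *v ?x) = P *v (D *v ?x) - s *s (P *v ?x)"
    unfolding matrix_vector_mult_diff_rdistrib mat_vector_mult
    by (simp only: matrix_vector_mul_assoc AP)
  also have "\<dots> = P *v (D *v ?x - s *s ?x)"
    by (simp add: matrix_vector_mult_diff_distrib vector_scalar_commute)
  also have "D *v ?x - s *s ?x = beta"
  proof -
    have "diag j * (beta $ j / (diag j - s)) - s * (beta $ j / (diag j - s)) = beta $ j" for j
      unfolding left_diff_distrib[symmetric] using nz[of j] by simp
    then show ?thesis by (simp add: diagonal_mat_mult_vector[OF diagonal_D] vec_eq_iff)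
  qed
  also have "P *v beta = b"
    by (simp add: beta_def matrix_vector_mul_assoc matrix_inv_mult(1)[OF invertible_P])
  finally have "resolvent A s *v b = (matrix_inv (A - mat s) ** (A - mat s)) *v (P *v ?x)"
    by (simp add: resolvent_def matrix_vector_mul_assoc[symmetric])
  then show ?thesis
    by (simp add: matrix_inv_mult(2)[OF inv])
qed

lemma transfer_function_eq:
  assumes "s \<notin> range diag"
  shows "transfer_function A b c s = (\<Sum>j\<in>UNIV. residue j / (diag j - s))"
  unfolding transfer_function_def resolvent_mult[OF assms]
    scalar_product_matrix_vector gamma_def[symmetric]
  by (simp add: scalar_product_def residue_def)

sublocale pole_data diag residue
  using inj_diag gamma_beta_nonzero transfer_function_nonzero
  by unfold_locales (auto simp: spectrum_A transfer_function_eq residue_def)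

text \<open>Both branches of the definition become one formula. Off the spectrum it is the
  normalised resolvent expansion; at \<open>diag k\<close> only \<open>phi k\<close> survives, with
  value \<open>1 / (gamma $ k * beta $ k)\<close>, so \<open>beta $ k\<close> cancels and the
  normalised eigenvector remains.\<close>

lemma dpse_f_eq: "dpse_f A b c P D s = P *v (\<chi> j. beta $ j * phi j s)"
proof (cases "s \<in> range diag")
  case False
  then have "dpse_f A b c P D s
      = inverse (\<Sum>j\<in>UNIV. residue j / (diag j - s)) *s (P *v (\<chi> j. beta $ j / (diag j - s)))"
    by (simp only: dpse_f_def spectrum_A resolvent_mult transfer_function_eq not_False_eq_True if_True)
  also have "\<dots> = P *v (\<chi> j. beta $ j * phi j s)"
    unfolding vector_scalar_commute[symmetric] phi_regular[OF False]
    by (intro arg_cong[where f = "\<lambda>x. P *v x"]) (simp add: vec_eq_iff)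
  finally show ?thesis .
next
  case True
  then obtain k where s: "s = diag k" by blast
  have "(THE j. diag j = s) = k"
    using injD[OF inj_diag] by (intro the_equality) (auto simp: s)
  then have "dpse_f A b c P D s = inverse (gamma $ k) *s (P *v axis k 1)"
    using True by (simp add: dpse_f_def spectrum_A Let_def gamma_component)
  also have "\<dots> = P *v (\<chi> j. beta $ j * phi j s)"
    unfolding vector_scalar_commute[symmetric] s phi_pole residue_def using gamma_beta_nonzero[of k]
    by (intro arg_cong[where f = "\<lambda>x. P *v x"]) (auto simp: vec_eq_iff axis_def field_simps)
  finally show ?thesis .
qed

lemma transpose_A: "transpose A = transpose (matrix_inv P) ** D ** matrix_inv (transpose (matrix_inv P))"
  by (simp add: A_eq matrix_transpose_mul matrix_inv_transpose[OF invertible_P]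
      transpose_diagonal_mat[OF diagonal_D] matrix_mul_assoc)

text \<open>The resolvent of the transpose is the transposed resolvent, and moving it across the
  bilinear product exchanges \<open>b\<close> and \<open>c\<close>.\<close>

lemma transposed_transfer_function:
  assumes "s \<notin> range diag"
  shows "transfer_function (transpose A) c b s = transfer_function A b c s"
proof -
  let ?N = "A - mat s"
  have inv: "invertible ?N"
    using assms by (rule invertible_regular)
  have "transpose A - mat s = transpose ?N"
    by (auto simp: vec_eq_iff transpose_def mat_def)
  moreover have "transpose (matrix_inv ?N) ** transpose ?N = mat 1"
    by (metis matrix_inv_mult(1)[OF inv] matrix_transpose_mul transpose_mat)
  then have "matrix_inv (transpose ?N) = transpose (matrix_inv ?N)"
    by (rule matrix_inv_eqI)
  ultimately have "resolvent (transpose A) s = transpose (resolvent A s)"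
    by (simp add: resolvent_def)
  then have "transfer_function (transpose A) c b s = scalar_product (resolvent A s *v b) c"
    by (simp only: transfer_function_def scalar_product_matrix_vector transpose_transpose)
  then show ?thesis
    by (simp only: transfer_function_def scalar_product_commute[of c])
qed

lemma transposed:
  "diagonalized_system (transpose A) (transpose (matrix_inv P)) D c b"
proof
  show "transfer_function (transpose A) c b s \<noteq> 0" if "s \<notin> mat_spectrum (transpose A)" for s
    using that transfer_function_nonzero[of s] transposed_transfer_function[of s]
    unfolding transpose_A mat_spectrum_diagonalized[OF matrix_inv_transpose(1)[OF invertible_P] diagonal_D]
    by (simp add: spectrum_A)
  have "scalar_product b (transpose (matrix_inv P) *v axis k 1) = beta $ k" for k
    by (simp only: scalar_product_matrix_vector transpose_transpose scalar_product_axis beta_def)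
  moreover have "scalar_product (axis k 1) (transpose P *v c) = gamma $ k" for k
    by (simp only: gamma_def scalar_product_commute[of "axis k 1"] scalar_product_axis)
  ultimately show "scalar_product b (transpose (matrix_inv P) *v axis k 1) *
      scalar_product (axis k 1) (matrix_inv (transpose (matrix_inv P)) *v c) \<noteq> 0" for k
    using gamma_beta_nonzero[of k] by (simp add: matrix_inv_transpose(2)[OF invertible_P])
qed (use transpose_A matrix_inv_transpose[OF invertible_P] diagonal_D inj_diag in simp_all)

text \<open>This is \<open>dpse_f_eq\<close> for the transposed system. Its residues are the same
  products \<open>gamma $ j * beta $ j\<close>, so its \<open>phi\<close> is the same
  function.\<close>

lemma dpse_g_eq: "dpse_g A b c P D s = transpose (matrix_inv P) *v (\<chi> j. gamma $ j * phi j s)"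
proof -
  interpret T: diagonalized_system "transpose A" "transpose (matrix_inv P)" D c b
    by (rule transposed)
  have swap: "T.beta = gamma" "T.gamma = beta"
    by (simp_all add: T.beta_def T.gamma_def beta_def gamma_def matrix_inv_transpose[OF invertible_P])
  have residue: "T.residue = residue"
    by (simp add: fun_eq_iff T.residue_def residue_def swap)
  have "dpse_g A b c P D s = dpse_f (transpose A) c b (transpose (matrix_inv P)) D s"
    using transposed_transfer_function[of s]
    by (simp add: dpse_g_def dpse_f_def spectrum_A T.spectrum_A)
  then show ?thesis
    by (simp only: T.dpse_f_eq residue swap)
qed

lemma weighted_gram_eq:
  "weighted_gram v S = transpose (\<chi> j k. gamma $ j * phi j (S $ k)) ** (\<chi> j k. v j * (beta $ j * phi j (S $ k)))"
  by (simp add: weighted_gram_def matrix_matrix_mult_def transpose_def vec_eq_iff residue_def mult_ac)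

lemma dpse_X_eq: "dpse_X A b c P D S = P ** (\<chi> j k. beta $ j * phi j (S $ k))"
  by (simp add: dpse_X_def dpse_f_eq vec_eq_iff matrix_vector_mult_def matrix_matrix_mult_def)

lemma transpose_dpse_Y_eq:
  "transpose (dpse_Y A b c P D S) = transpose (\<chi> j k. gamma $ j * phi j (S $ k)) ** matrix_inv P"
proof -
  have "dpse_Y A b c P D S = transpose (matrix_inv P) ** (\<chi> j k. gamma $ j * phi j (S $ k))"
    by (simp add: dpse_Y_def dpse_g_eq vec_eq_iff matrix_vector_mult_def matrix_matrix_mult_def)
  then show ?thesis by (simp add: matrix_transpose_mul)
qed

lemma dpse_gram_eq: "dpse_gram A b c P D S = weighted_gram (\<lambda>_. 1) S"
proof -
  have "dpse_gram A b c P D S = transpose (\<chi> j k. gamma $ j * phi j (S $ k)) **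
      (matrix_inv P ** P) ** (\<chi> j k. beta $ j * phi j (S $ k))"
    by (simp add: dpse_gram_def dpse_X_eq transpose_dpse_Y_eq matrix_mul_assoc)
  then show ?thesis
    by (simp add: matrix_inv_mult(2)[OF invertible_P] weighted_gram_eq)
qed

lemma dpse_numerator_eq:
  fixes S :: "complex^'p"
  shows "transpose (dpse_Y A b c P D S) ** A ** dpse_X A b c P D S = weighted_gram diag S"
proof -
  have "D ** (\<chi> j k. M j k) = (\<chi> j k. diag j * M j k)" for M :: "'n \<Rightarrow> 'p \<Rightarrow> complex"
    using diagonal_mat_mult_vector[OF diagonal_D, of "\<chi> j. M j _"]
    by (simp add: vec_eq_iff matrix_vector_mult_def matrix_matrix_mult_def)
  moreover have "transpose (dpse_Y A b c P D S) ** A ** dpse_X A b c P D S =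
      transpose (\<chi> j k. gamma $ j * phi j (S $ k)) **
      ((matrix_inv P ** P) ** D ** (matrix_inv P ** P)) ** (\<chi> j k. beta $ j * phi j (S $ k))"
    unfolding transpose_dpse_Y_eq dpse_X_eq by (subst A_eq) (simp only: matrix_mul_assoc)
  ultimately show ?thesis
    by (simp add: matrix_inv_mult(2)[OF invertible_P] weighted_gram_eq flip: matrix_mul_assoc)
qed

text \<open>Multiplying \<open>mat z - dpse_F A b c P D S\<close> by the Gram matrix clears the
  inverse, and linearity of \<open>weighted_gram\<close> in the weights combines the two
  terms.\<close>

lemma charpoly_dpse_F:
  assumes "invertible (dpse_gram A b c P D S)"
  shows "poly (charpoly (dpse_F A b c P D S)) z
    = det (weighted_gram (\<lambda>j. z - diag j) S) / det (weighted_gram (\<lambda>_. 1) S)"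
proof -
  let ?M = "dpse_gram A b c P D S" and ?K = "weighted_gram diag S"
  have "?M ** (mat z - matrix_inv ?M ** ?K) = ?M ** mat z - ?K"
    by (simp only: matrix_diff_ldistrib matrix_mul_assoc matrix_inv_mult(1)[OF assms] matrix_mul_lid)
  also have "\<dots> = weighted_gram (\<lambda>j. z - diag j) S"
    by (simp add: matrix_mat_mult dpse_gram_eq weighted_gram_def vec_eq_iff sum_distrib_left
        sum_subtractf algebra_simps)
  finally have "det ?M * det (mat z - dpse_F A b c P D S) = det (weighted_gram (\<lambda>j. z - diag j) S)"
    by (simp only: dpse_F_def dpse_numerator_eq det_mul[symmetric])
  moreover have "det ?M \<noteq> 0" using assms invertible_det_nz by blast
  ultimately show ?thesis
    by (simp add: poly_charpoly dpse_gram_eq eq_divide_eq mult.commute)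
qed

end

section \<open>Existence and second-order contraction of the DPSE map\<close>

context diagonalized_system
begin

context
  fixes lam :: "complex^'p" and a :: "'p \<Rightarrow> 'n"
  assumes inj_a: "inj a" and lam: "\<And>k. lam $ k = diag (a k)"
begin

lemma inj_lam: "inj (\<lambda>i. lam $ i)"
  using inj_compose[OF inj_diag inj_a] by (simp add: lam comp_def)

text \<open>Where the Gram determinant is nonzero, the values of the characteristic polynomial
  depend continuously on \<open>S\<close>, so its roots can be labelled continuously near
  \<open>lam\<close>. Being \<open>CARD('p)\<close> distinct roots, they are simple and make up the
  whole spectrum.\<close>

lemma ex_dpse_map: "\<exists>Z G. is_dpse_map A b c P D lam Z G"
proof -
  define W where "W = {S :: complex^'p. det (weighted_gram (\<lambda>_. 1) S) \<noteq> 0}"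
  have inv: "invertible (dpse_gram A b c P D S) \<longleftrightarrow> S \<in> W" for S :: "complex^'p"
    by (simp add: W_def dpse_gram_eq invertible_det_nz)
  have "open W"
    unfolding W_def by (intro open_Collect_neq continuous_det_weighted_gram continuous_on_const)
  have "lam \<in> W"
    using w_nonzero
    by (simp add: W_def det_weighted_gram_poles[OF inj_a lam])
  have "continuous_on W (\<lambda>S. poly (charpoly (dpse_F A b c P D S)) z)" for z
  proof -
    have "continuous_on W (\<lambda>S. det (weighted_gram (\<lambda>j. z - diag j) S) / det (weighted_gram (\<lambda>_. 1) S))"
      by (intro continuous_on_divide continuous_on_subset[OF continuous_det_weighted_gram])
        (auto simp: W_def)
    then show ?thesis
      by (subst continuous_on_cong[OF refl charpoly_dpse_F]) (auto simp: inv)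
  qed
  moreover have "poly (charpoly (dpse_F A b c P D lam)) (lam $ i) = 0" for i
    using \<open>lam \<in> W\<close> by (subst charpoly_dpse_F) (auto simp: inv det_weighted_gram_poles[OF inj_a lam] lam)
  ultimately obtain Z G where Z: "open Z" "lam \<in> Z" "Z \<subseteq> W" "continuous_on Z G" "G lam = lam"
    and G: "\<And>S. S \<in> Z \<Longrightarrow> inj (\<lambda>i. G S $ i)"
      "\<And>S i. S \<in> Z \<Longrightarrow> poly (charpoly (dpse_F A b c P D S)) (G S $ i) = 0"
    using ex_continuous_root_labelling[OF \<open>open W\<close> \<open>lam \<in> W\<close> charpoly_monic charpoly_degree _ inj_lam,
        of "dpse_F A b c P D"] by blast
  have spec: "mat_spectrum (dpse_F A b c P D S) = range (\<lambda>i. G S $ i)" if "S \<in> Z" for S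
    using poly_eq_prod_roots(3)[OF charpoly_monic charpoly_degree G(1)[OF that] G(2)[OF that]]
    by (auto simp: mem_mat_spectrum_iff set_eq_iff)
  have "simple_eigenvalue (dpse_F A b c P D S) z" if "S \<in> Z" "z \<in> mat_spectrum (dpse_F A b c P D S)" for S z
    using poly_eq_prod_roots(2)[OF charpoly_monic charpoly_degree G(1)[OF that(1)] G(2)[OF that(1)]] that
    by (auto simp: simple_eigenvalue_def spec)
  then have "is_dpse_map A b c P D lam Z G"
    unfolding is_dpse_map_def using Z G(1) inv spec by (auto simp: bij_betw_def)
  then show ?thesis by blast
qed

text \<open>At \<open>lam $ i\<close> the weights \<open>lam $ i - diag j\<close> vanish for
  \<open>j = a i\<close>, so the characteristic polynomial of \<open>dpse_F\<close> is of second
  order there; \<open>root_labelling_bigo\<close> passes this on to component \<open>i\<close> of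
  \<open>G\<close>.\<close>

lemma dpse_map_quadratic:
  assumes map: "is_dpse_map A b c P D lam Z G"
  shows "\<exists>C. \<forall>\<^sub>F S in nhds lam. norm (G S - lam) \<le> C * (norm (S - lam))\<^sup>2"
proof -
  let ?g = "\<lambda>S. of_real (norm (S - lam)) ^ 2 :: complex"
  have Z: "open Z" "lam \<in> Z" and G: "continuous_on Z G" "G lam = lam"
    and inv: "\<And>S. S \<in> Z \<Longrightarrow> invertible (dpse_gram A b c P D S)"
    and bij: "\<And>S. S \<in> Z \<Longrightarrow> bij_betw (\<lambda>i. G S $ i) UNIV (mat_spectrum (dpse_F A b c P D S))"
    using map unfolding is_dpse_map_def by blast+
  have evZ: "\<forall>\<^sub>F S in nhds lam. S \<in> Z"
    using eventually_nhds_in_open[OF Z] .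
  have contG: "isCont G lam"
    using G(1) Z continuous_on_eq_continuous_at by blast
  have component: "(\<lambda>S. G S $ i - lam $ i) \<in> O[nhds lam](?g)" for i
  proof -
    let ?r = "\<lambda>S. det (weighted_gram (\<lambda>j. lam $ i - diag j) S) * inverse (det (weighted_gram (\<lambda>_. 1) S))"
    have "isCont (\<lambda>S. inverse (det (weighted_gram (\<lambda>_. 1) S))) lam"
      using continuous_det_weighted_gram[of "\<lambda>_. 1"] inv[OF Z(2)]
      by (intro continuous_at_within_inverse)
        (auto simp: continuous_on_eq_continuous_at dpse_gram_eq invertible_det_nz)
    then have "(\<lambda>S. inverse (det (weighted_gram (\<lambda>_. 1) S))) \<in> O[nhds lam](\<lambda>_. 1)"
      by (rule continuous_at_imp_bigo_1)
    then have "?r \<in> O[nhds lam](\<lambda>S. ?g S * 1)"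
      by (intro landau_o.big.mult det_weighted_gram_bigo[where a = a and i = i] inj_a) (auto simp: lam)
    then have r: "?r \<in> O[nhds lam](?g)" by simp
    have "\<forall>\<^sub>F S in nhds lam. ?r S = (\<Prod>j\<in>UNIV. G lam $ i - G S $ j)"
      using evZ
    proof eventually_elim
      case (elim S)
      have "inj (\<lambda>j. G S $ j)" "\<And>j. poly (charpoly (dpse_F A b c P D S)) (G S $ j) = 0"
        using bij[OF elim] by (auto simp: bij_betw_def mem_mat_spectrum_iff[symmetric])
      from poly_eq_prod_roots(1)[OF charpoly_monic charpoly_degree this]
      have "poly (charpoly (dpse_F A b c P D S)) (lam $ i) = (\<Prod>j\<in>UNIV. lam $ i - G S $ j)"
        by (simp add: poly_prod)
      then show ?case
        by (simp add: charpoly_dpse_F[OF inv[OF elim]] G(2) divide_inverse)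
    qed
    from root_labelling_bigo[OF contG _ this r] show ?thesis
      using inj_lam by (simp add: G(2))
  qed
  \<comment> \<open>The sum of the component norms dominates the norm of the vector and yields one
    constant for all components.\<close>
  have "(\<lambda>S. \<Sum>i\<in>UNIV. of_real (norm (G S $ i - lam $ i))) \<in> O[nhds lam](?g)"
  proof (rule big_sum_in_bigo)
    fix i
    show "(\<lambda>S. of_real (norm (G S $ i - lam $ i))) \<in> O[nhds lam](?g)"
      using component[of i] by (simp add: bigo_def)
  qed
  then obtain C where C: "\<forall>\<^sub>F S in nhds lam.
      norm (\<Sum>i\<in>UNIV. of_real (norm (G S $ i - lam $ i)) :: complex) \<le> C * norm (?g S)"
    by (elim landau_o.bigE) blast
  have "\<forall>\<^sub>F S in nhds lam. norm (G S - lam) \<le> C * (norm (S - lam))\<^sup>2"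
    using C
  proof eventually_elim
    case (elim S)
    have "norm (G S - lam) \<le> (\<Sum>i\<in>UNIV. norm (G S $ i - lam $ i))"
      unfolding norm_vec_def[of "G S - lam"] vector_minus_component[symmetric] by (rule L2_set_le_sum) simp
    also have "\<dots> = norm (\<Sum>i\<in>UNIV. of_real (norm (G S $ i - lam $ i)) :: complex)"
      by (simp only: of_real_sum[symmetric] norm_of_real abs_of_nonneg sum_nonneg norm_ge_zero)
    also have "\<dots> \<le> C * (norm (S - lam))\<^sup>2"
      using elim by (simp add: norm_power)
    finally show ?case .
  qed
  then show ?thesis by blast
qed

end
end

text \<open>The first conjunct keeps the second from being vacuous; the second covers every
  admissible choice of the domain and the labelling.\<close>

theorem proposition2:
  fixes A :: "real^'n^'n" and b c :: "real^'n"
    and P D :: "complex^'n^'n" and lam :: "complex^'p"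
  assumes "invertible P" and "diagonal_mat D"
    and "complex_mat A = P ** D ** matrix_inv P"
    and "\<forall>z\<in>mat_spectrum (complex_mat A). simple_eigenvalue (complex_mat A) z"
    and "\<forall>s. s \<notin> mat_spectrum (complex_mat A) \<longrightarrow>
           transfer_function (complex_mat A) (complex_vec b) (complex_vec c) s \<noteq> 0"
    and "\<forall>k. scalar_product (complex_vec c) (P *v axis k 1) *
             scalar_product (axis k 1) (matrix_inv P *v complex_vec b) \<noteq> 0"
    and "\<forall>i. lam $ i \<in> mat_spectrum (complex_mat A)"
    and "inj (\<lambda>i. lam $ i)"
  shows "(\<exists>Z G. is_dpse_map (complex_mat A) (complex_vec b) (complex_vec c) P D lam Z G) \<and>
    (\<forall>Z G. is_dpse_map (complex_mat A) (complex_vec b) (complex_vec c) P D lam Z G \<longrightarrow>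
       (\<exists>V. open V \<and> lam \<in> V \<and> (\<forall>S0\<in>V. iteration_converges_quadratically Z G S0 lam)))"
proof -
  interpret diagonalized_system "complex_mat A" P D "complex_vec b" "complex_vec c"
  proof
    show "inj (\<lambda>j. D $ j $ j)"
      using inj_diagonal_of_simple[OF assms(1,2)] assms(3,4) by simp
  qed (use assms(1-3,5,6) in auto)
  have "\<forall>i. \<exists>j. lam $ i = D $ j $ j"
    using assms(7) spectrum_A by auto
  then obtain a where a: "\<And>i. lam $ i = D $ a i $ a i"
    by metis
  have "inj a"
    using assms(8) by (auto simp: inj_def a)
  have "\<exists>V. open V \<and> lam \<in> V \<and> (\<forall>S0\<in>V. iteration_converges_quadratically Z G S0 lam)"
    if map: "is_dpse_map (complex_mat A) (complex_vec b) (complex_vec c) P D lam Z G" for Z G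
  proof -
    have "open Z" "lam \<in> Z"
      using map by (simp_all add: is_dpse_map_def)
    then show ?thesis
      using dpse_map_quadratic[OF \<open>inj a\<close> a map] iteration_converges_quadratically_near by blast
  qed
  with ex_dpse_map[OF \<open>inj a\<close> a] show ?thesis by blast
qed

end
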